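(* For predicate transformers $S, T$ of type $\mathcal P\Psi \times \mathcal P\Sigma \to \mathcal P\Sigma$: \[ S \precsim T \;\equiv\; \forall p, q, r\cdot \big(\{|p|\}\ S\ \{|q, r|\} \Rightarrow \{|p|\}\ T\ \{|q, r|\}\big),\] with $p, r$ ranging over state predicates on $\Sigma$ and $q$ over state predicates on $\Psi$.
   Context: A state predicate on $\Sigma$ is a function $\Sigma\to Bool$; $\wedge,\vee$ are pointwise and $u\le v$ iff $\forall\sigma.\ u\,\sigma\Rightarrow v\,\sigma$. A predicate transformer of type $\mathcal P\Psi \times \mathcal P\Sigma \to \mathcal P\Sigma$ maps a normal postcondition on $\Psi$ and an exceptional postcondition on $\Sigma$ to a precondition on $\Sigma$. $\mathsf{raise}(q,r) = r$; $(S\sqcap T)(q,r) = S(q,r)\wedge T(q,r)$; total refinement $S\sqsubseteq T$ iff $\forall q,r.\ S(q,r)\le T(q,r)$. Partial refinement: $S \precsim T \;\widehat=\; S \sqcap \mathsf{raise} \sqsubseteq T$. Partial correctness: $\{|p|\}\ S\ \{|q,r|\} \;\widehat=\; p \le S(q, p\vee r)$. *)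

theory Defs
  imports Main
begin

text \<open>The lattice structure and order on state predicates are the library's pointwise
  ones on functions into \<^typ>\<open>bool\<close>.\<close>

type_synonym 's pred = "'s \<Rightarrow> bool"

text \<open>A transformer maps a pair (normal postcondition, exceptional postcondition) to a
  precondition. Transformers are arbitrary functions; in particular, they are not required
  to be monotonic.\<close>

type_synonym ('f, 's) ptran = "'f pred \<times> 's pred \<Rightarrow> 's pred"

definition raise :: "('f, 's) ptran" where
  "raise = (\<lambda>(q, r). r)"

definition meet :: "('f, 's) ptran \<Rightarrow> ('f, 's) ptran \<Rightarrow> ('f, 's) ptran" where
  "meet S T = (\<lambda>(q, r). inf (S (q, r)) (T (q, r)))"

definition total_refines :: "('f, 's) ptran \<Rightarrow> ('f, 's) ptran \<Rightarrow> bool" where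
  "total_refines S T \<longleftrightarrow> (\<forall>q r. S (q, r) \<le> T (q, r))"

definition partial_refines :: "('f, 's) ptran \<Rightarrow> ('f, 's) ptran \<Rightarrow> bool" where
  "partial_refines S T \<longleftrightarrow> total_refines (meet S raise) T"

definition partial_correct ::
  "'s pred \<Rightarrow> ('f, 's) ptran \<Rightarrow> 'f pred \<Rightarrow> 's pred \<Rightarrow> bool" where
  "partial_correct p S q r \<longleftrightarrow> p \<le> S (q, sup p r)"

end

theory Submission
  imports Defs
begin

text \<open>Meeting with \<open>raise\<close> restricts a precondition to states satisfying the
  exceptional postcondition. A triple has this restriction built in: its exceptional postcondition
  \<open>sup p r\<close> already contains \<open>p\<close>. Conversely, the weakest precondition
  below \<open>r\<close>, taken as \<open>p\<close>, turns the triples back into refinement at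
  \<open>(q, r)\<close>.\<close>

lemma partial_refines_iff:
  "partial_refines S T \<longleftrightarrow> (\<forall>q r. inf (S (q, r)) r \<le> T (q, r))"
  by (simp add: partial_refines_def total_refines_def meet_def raise_def)

theorem theorem5:
  fixes S T :: "('f, 's) ptran"
  shows "partial_refines S T \<longleftrightarrow>
    (\<forall>(p :: 's pred) (q :: 'f pred) (r :: 's pred).
      partial_correct p S q r \<longrightarrow> partial_correct p T q r)"
proof
  assume refines: "partial_refines S T"
  show "\<forall>p q r. partial_correct p S q r \<longrightarrow> partial_correct p T q r"
  proof (intro allI impI)
    fix p r :: "'s pred" and q :: "'f pred"
    assume "partial_correct p S q r"
    \<comment> \<open>The second bound is free, and it lets refinement apply at
      \<open>(q, sup p r)\<close>.\<close>
    then have "p \<le> inf (S (q, sup p r)) (sup p r)"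
      by (simp add: partial_correct_def)
    also have "\<dots> \<le> T (q, sup p r)"
      using refines unfolding partial_refines_iff by blast
    finally show "partial_correct p T q r"
      by (simp add: partial_correct_def)
  qed
next
  assume correct: "\<forall>p q r. partial_correct p S q r \<longrightarrow> partial_correct p T q r"
  show "partial_refines S T"
    unfolding partial_refines_iff
  proof (intro allI)
    fix q :: "'f pred" and r :: "'s pred"
    \<comment> \<open>The largest \<open>p \<le> r\<close> that is partially correct for \<open>S\<close>: joining it to \<open>r\<close> changes nothing.\<close>
    let ?p = "inf (S (q, r)) r"
    have absorb: "sup ?p r = r"
      by (simp add: sup_absorb2)
    then have "partial_correct ?p S q r"
      by (simp add: partial_correct_def)
    then have "partial_correct ?p T q r"
      using correct by blast
    then show "?p \<le> T (q, r)"
      unfolding partial_correct_def absorb .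
  qed
qed

end
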